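(* Let $G$ be a graph and let $G_{\mathrm{R\text{-}core}}$ be an R-core of $G$. Then $G_{\mathrm{R\text{-}core}}$ is isomorphic to an induced subgraph of $G$.
   Context: Graphs are finite and undirected, with loops allowed: $G=(V_G,E_G)$ with $E_G\subseteq V_G\times V_G$ symmetric. A relation $R\subseteq X\times Y$ has full domain if every $x\in X$ is related to some $p\in Y$, and full image if every $p\in Y$ is related to by some $x\in X$. For a graph $G$, a finite set $B$ and a relation $R\subseteq V_G\times B$ with full image, $G\ast R$ is the graph with vertex set $B$ and edge set $\{(u,v)\in B\times B : \text{there is } (x,y)\in E_G \text{ with } (x,u),(y,v)\in R\}$. The equation $G\ast R=H$ means that $R\subseteq V_G\times V_H$ has full image and $G\ast R$ equals $H$ as a graph. Graphs $G,H$ are weakly relationally equivalent, $G\backsim_w H$, if there are relations $R\subseteq V_G\times V_H$ and $S\subseteq V_H\times V_G$, both with full domain, such that $G\ast R=H$ and $H\ast S=G$. A graph is an R-core if it has the smallest number of vertices among all graphs in its $\backsim_w$-equivalence class. $H$ is an R-core of $G$ if $H$ is an R-core and $H\backsim_w G$; it is unique up to isomorphism and is denoted $G_{\mathrm{R\text{-}core}}$. *)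

theory Defs
  imports "Graph_Theory.Graph_Theory"
begin

text \<open>
  Finite undirected graphs with loops allowed (and without parallel edges) are the
  \<^locale>\<open>pair_pseudo_graph\<close>s of the Graph Theory library: a finite vertex set together
  with a symmetric set of pairs of vertices.
\<close>

text \<open>
  The target set \<open>B\<close> of the relation does not appear as an argument: \<open>G \<star> R\<close> is only
  considered when \<open>R\<close> has full image, that is, when \<open>B = Range R\<close>.
\<close>

definition rel_product ::
  "'a pair_pre_digraph \<Rightarrow> ('a \<times> 'b) set \<Rightarrow> 'b pair_pre_digraph" (infixl "\<star>" 70)
where
  "G \<star> R = \<lparr> pverts = Range R,
             parcs = {(u, v). \<exists>x y. (x, y) \<in> parcs G \<and> (x, u) \<in> R \<and> (y, v) \<in> R} \<rparr>"

definition star_equation ::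
  "'a pair_pre_digraph \<Rightarrow> ('a \<times> 'b) set \<Rightarrow> 'b pair_pre_digraph \<Rightarrow> bool"
where
  "star_equation G R H \<longleftrightarrow>
     R \<subseteq> pverts G \<times> pverts H \<and> Range R = pverts H \<and> G \<star> R = H"

definition weakly_rel_equiv ::
  "'a pair_pre_digraph \<Rightarrow> 'b pair_pre_digraph \<Rightarrow> bool" (infix "\<sim>\<^sub>w" 50)
where
  "G \<sim>\<^sub>w H \<longleftrightarrow> pair_pseudo_graph G \<and> pair_pseudo_graph H \<and>
     (\<exists>R S. Domain R = pverts G \<and> star_equation G R H \<and>
            Domain S = pverts H \<and> star_equation H S G)"

text \<open>
  ``All graphs in the equivalence class'' ranges over graphs whose vertices are natural
  numbers. Every finite graph is isomorphic to one of these, so this is no restriction;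
  see \<open>R_core_minimal\<close> below.
\<close>

definition R_core :: "'a pair_pre_digraph \<Rightarrow> bool" where
  "R_core H \<longleftrightarrow> pair_pseudo_graph H \<and>
     (\<forall>K :: nat pair_pre_digraph. K \<sim>\<^sub>w H \<longrightarrow> card (pverts H) \<le> card (pverts K))"

definition R_core_of :: "'b pair_pre_digraph \<Rightarrow> 'a pair_pre_digraph \<Rightarrow> bool" where
  "R_core_of H G \<longleftrightarrow> R_core H \<and> H \<sim>\<^sub>w G"

lemma R_core_minimal:
  fixes H :: "'a pair_pre_digraph" and K :: "'c pair_pre_digraph"
  assumes "R_core H" and "K \<sim>\<^sub>w H"
  shows "card (pverts H) \<le> card (pverts K)"
proof -
  from assms(2) obtain R S where K: "pair_pseudo_graph K" and H: "pair_pseudo_graph H"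
    and DR: "Domain R = pverts K" and R: "star_equation K R H"
    and DS: "Domain S = pverts H" and S: "star_equation H S K"
    unfolding weakly_rel_equiv_def by blast
  interpret K: pair_pseudo_graph K by (rule K)
  obtain f :: "'c \<Rightarrow> nat" where f: "inj_on f (pverts K)"
    using finite_imp_inj_to_nat_seg[OF K.pair_finite_verts] by blast
  define K' where "K' = \<lparr> pverts = f ` pverts K, parcs = (\<lambda>(x, y). (f x, f y)) ` parcs K \<rparr>"
  define R' where "R' = (\<lambda>(x, u). (f x, u)) ` R"
  define S' where "S' = (\<lambda>(u, x). (u, f x)) ` S"
  have sK: "(x, y) \<in> parcs K \<Longrightarrow> (y, x) \<in> parcs K" for x y
    using K.pair_sym_arcs by (auto simp: symmetric_def sym_def)
  have arcsK': "(a, b) \<in> parcs K' \<longleftrightarrow> (\<exists>x y. (x, y) \<in> parcs K \<and> a = f x \<and> b = f y)" for a b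
    by (force simp: K'_def)
  have graph: "pair_pseudo_graph K'"
  proof unfold_locales
    show "symmetric (with_proj K')"
      using sK by (auto simp: K'_def symmetric_def intro!: symI)
  qed (use K.pair_finite_verts K.pair_finite_arcs K.wellformed' in \<open>auto simp: K'_def\<close>)
  have RK: "R \<subseteq> pverts K \<times> pverts H" and RH: "Range R = pverts H" and KR: "K \<star> R = H"
    using R by (auto simp: star_equation_def)
  have SK: "S \<subseteq> pverts H \<times> pverts K" and SR: "Range S = pverts K" and HS: "H \<star> S = K"
    using S by (auto simp: star_equation_def)
  have R': "(f x, u) \<in> R' \<longleftrightarrow> (x, u) \<in> R" if "x \<in> pverts K" for x u
    using that RK f by (auto simp: R'_def dest: inj_onD)
  have "parcs (K' \<star> R') = parcs (K \<star> R)"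
  proof -
    have "(u, v) \<in> parcs (K' \<star> R') \<longleftrightarrow> (u, v) \<in> parcs (K \<star> R)" for u v
    proof -
      have "(u, v) \<in> parcs (K' \<star> R') \<longleftrightarrow>
          (\<exists>x y. (x, y) \<in> parcs K \<and> (f x, u) \<in> R' \<and> (f y, v) \<in> R')"
        by (simp add: rel_product_def arcsK') blast
      also have "\<dots> \<longleftrightarrow> (\<exists>x y. (x, y) \<in> parcs K \<and> (x, u) \<in> R \<and> (y, v) \<in> R)"
        using R' K.wellformed' by blast
      finally show ?thesis by (simp add: rel_product_def)
    qed
    then show ?thesis by auto
  qed
  moreover have "Range R' = Range R" by (force simp: R'_def)
  ultimately have "K' \<star> R' = H"
    unfolding KR[symmetric] by (intro pair_pre_digraph.equality) (auto simp: rel_product_def)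
  moreover have "R' \<subseteq> pverts K' \<times> pverts H" "Range R' = pverts H"
    using RK RH \<open>Range R' = Range R\<close> by (auto simp: R'_def K'_def)
  moreover have DR': "Domain R' = pverts K'" using DR by (force simp: R'_def K'_def)
  ultimately have 1: "star_equation K' R' H" by (auto simp: star_equation_def)
  have RS': "Range S' = f ` Range S" by (force simp: S'_def)
  have S': "(u, a) \<in> S' \<longleftrightarrow> (\<exists>x. (u, x) \<in> S \<and> a = f x)" for u a
    by (force simp: S'_def)
  have arcsK: "(x, y) \<in> parcs K \<longleftrightarrow>
      (\<exists>u v. (u, v) \<in> parcs H \<and> (u, x) \<in> S \<and> (v, y) \<in> S)" for x y
    unfolding HS[symmetric] by (simp add: rel_product_def)
  have "(a, b) \<in> parcs (H \<star> S') \<longleftrightarrow> (a, b) \<in> parcs K'" for a b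
    unfolding arcsK' arcsK by (simp add: rel_product_def S') blast
  then have "parcs (H \<star> S') = parcs K'" by auto
  then have "H \<star> S' = K'"
    using RS' SR by (intro pair_pre_digraph.equality) (auto simp: rel_product_def K'_def)
  moreover have "S' \<subseteq> pverts H \<times> pverts K'" using SK by (auto simp: S'_def K'_def)
  moreover have "Range S' = pverts K'" using RS' SR by (simp add: K'_def)
  ultimately have 2: "star_equation H S' K'" by (simp add: star_equation_def)
  have "Domain S' = pverts H" using DS by (force simp: S'_def)
  with 1 2 DR' graph H have "K' \<sim>\<^sub>w H" unfolding weakly_rel_equiv_def by blast
  with assms(1) have "card (pverts H) \<le> card (pverts K')" by (auto simp: R_core_def)
  also have "\<dots> = card (pverts K)" using f by (simp add: K'_def card_image)
  finally show ?thesis .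
qed

end

theory Submission
  imports Defs
begin

text \<open>
  Let \<open>C \<star> R = G\<close> and \<open>G \<star> S = C\<close>. The composition \<open>T = R O S\<close> satisfies \<open>C \<star> T = C\<close>. If a set
  \<open>A\<close> of vertices of \<open>C\<close> violated Hall's condition for \<open>T\<close>, then \<open>T\<close> would factor through the
  disjoint union of \<open>V - A\<close> and \<open>T `` A\<close>, which has fewer elements than \<open>V\<close>, and \<open>C\<close> would be
  weakly equivalent to a smaller graph. So \<open>T\<close> contains a permutation \<open>p\<close>, which is an
  automorphism of \<open>C\<close>. Choose \<open>f x\<close> with \<open>(x, f x) \<in> R\<close> and \<open>(f x, p x) \<in> S\<close>. Then \<open>f\<close> preserves
  and reflects edges; two vertices with the same image under \<open>f\<close> have the same neighbours, and
  an R-core has no such pairs because they could be identified.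
\<close>

section \<open>Hall's theorem for finite relations\<close>

text \<open>Strong induction on \<open>A\<close>. If some nonempty proper subset \<open>B\<close> is
  tight, that is, has exactly \<open>card B\<close> neighbours, then \<open>B\<close> and
  \<open>A - B\<close> are matched separately. Otherwise one vertex is matched arbitrarily and the
  induction hypothesis handles the rest.\<close>

theorem hall:
  fixes T :: "('a \<times> 'b) set"
  assumes "finite A" and "finite T"
    and "\<And>B. B \<subseteq> A \<Longrightarrow> card B \<le> card (T `` B)"
  shows "\<exists>f. inj_on f A \<and> (\<forall>a\<in>A. (a, f a) \<in> T)"
  using assms
proof (induction A arbitrary: T rule: finite_psubset_induct)
  case (psubset A)
  have fin: "finite (T `` B)" for B
    using psubset.prems(1) by (rule finite_Image)
  have finA: "finite B" if "B \<subseteq> A" for B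
    using that psubset.hyps by (rule finite_subset)
  show ?case
  proof (cases "\<exists>B. B \<noteq> {} \<and> B \<subset> A \<and> card (T `` B) = card B")
    case True
    then obtain B where B: "B \<noteq> {}" "B \<subset> A" "card (T `` B) = card B" by blast
    have "\<exists>f. inj_on f B \<and> (\<forall>a\<in>B. (a, f a) \<in> T)"
      using B psubset.prems by (intro psubset.IH) auto
    then obtain f where f: "inj_on f B" "\<forall>a\<in>B. (a, f a) \<in> T" by blast
    define T' where "T' = T - UNIV \<times> T `` B"
    have "\<exists>g. inj_on g (A - B) \<and> (\<forall>a\<in>A - B. (a, g a) \<in> T')"
    proof (rule psubset.IH)
      fix D assume D: "D \<subseteq> A - B"
      \<comment> \<open>Hall's condition for \<open>B \<union> D\<close>, minus the tight equality
        for \<open>B\<close>, is Hall's condition for \<open>D\<close> in \<open>T'\<close>.\<close>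
      have "card B + card D = card (B \<union> D)"
        using D B finA[of B] finA[of D] by (subst card_Un_disjoint) auto
      also have "\<dots> \<le> card (T `` (B \<union> D))"
        using D B by (intro psubset.prems) auto
      also have "T `` (B \<union> D) = T `` B \<union> T' `` D"
        by (auto simp: T'_def)
      also have "card \<dots> \<le> card (T `` B) + card (T' `` D)"
        by (rule card_Un_le)
      finally show "card D \<le> card (T' `` D)" using B by simp
    qed (use B psubset.prems in \<open>auto simp: T'_def\<close>)
    then obtain g where g: "inj_on g (A - B)" "\<forall>a\<in>A - B. (a, g a) \<in> T'" by blast
    define h where "h a = (if a \<in> B then f a else g a)" for a
    have "inj_on h (B \<union> (A - B))"
      unfolding inj_on_Un
    proof (intro conjI)
      show "inj_on h B" using f by (auto simp: h_def inj_on_def)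
      show "inj_on h (A - B)" using g by (auto simp: h_def inj_on_def)
      show "h ` (B - (A - B)) \<inter> h ` (A - B - B) = {}"
        using f g by (fastforce simp: h_def T'_def)
    qed
    moreover have "B \<union> (A - B) = A" using B by auto
    moreover have "\<forall>a\<in>A. (a, h a) \<in> T" using f g by (auto simp: h_def T'_def)
    ultimately show ?thesis by auto
  next
    case False
    show ?thesis
    proof (cases "A = {}")
      case False
      then obtain a where a: "a \<in> A" by blast
      have "card {a} \<le> card (T `` {a})" using a by (intro psubset.prems) auto
      then have "T `` {a} \<noteq> {}" by auto
      then obtain b where b: "(a, b) \<in> T" by blast
      define T' where "T' = T - UNIV \<times> {b}"
      have "\<exists>g. inj_on g (A - {a}) \<and> (\<forall>x\<in>A - {a}. (x, g x) \<in> T')"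
      proof (rule psubset.IH)
        fix D assume D: "D \<subseteq> A - {a}"
        show "card D \<le> card (T' `` D)"
        proof (cases "D = {}")
          case False
          \<comment> \<open>\<open>D\<close> is nonempty and misses \<open>a\<close>, so it is a
            proper subset of \<open>A\<close> and not tight. It has at least one spare neighbour,
            which makes up for the possible loss of \<open>b\<close>.\<close>
          have "card D \<le> card (T `` D)" using D by (intro psubset.prems) auto
          moreover have "card (T `` D) \<noteq> card D"
            using \<open>\<nexists>B. B \<noteq> {} \<and> B \<subset> A \<and> card (T `` B) = card B\<close> False D a by blast
          moreover have "T' `` D = T `` D - {b}" by (auto simp: T'_def)
          then have "card (T `` D) - 1 \<le> card (T' `` D)"
            by (simp add: card_Diff_singleton_if)
          ultimately show ?thesis by linarith
        qed simp
      qed (use a psubset.prems in \<open>auto simp: T'_def\<close>)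
      then obtain g where g: "inj_on g (A - {a})" "\<forall>x\<in>A - {a}. (x, g x) \<in> T'" by blast
      have "inj_on (g(a := b)) A" "\<forall>x\<in>A. (x, (g(a := b)) x) \<in> T"
        using g b by (auto simp: inj_on_def T'_def)
      then show ?thesis by blast
    qed auto
  qed
qed

section \<open>Factorizations of an R-core\<close>

lemma pverts_rel_product [simp]: "pverts (G \<star> R) = Range R"
  by (simp add: rel_product_def)

lemma parcs_rel_product:
  "(u, v) \<in> parcs (G \<star> R) \<longleftrightarrow> (\<exists>x y. (x, y) \<in> parcs G \<and> (x, u) \<in> R \<and> (y, v) \<in> R)"
  by (simp add: rel_product_def)

lemma pair_pseudo_graph_arc_sym:
  "pair_pseudo_graph G \<Longrightarrow> (x, y) \<in> parcs G \<Longrightarrow> (y, x) \<in> parcs G"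
  using pair_sym_digraph.pair_sym_arcs[OF pair_pseudo_graph.axioms(2)]
  unfolding symmetric_def with_proj_simps by (blast dest: symD)

lemma pair_pseudo_graph_rel_product:
  assumes "pair_pseudo_graph G" and "finite R"
  shows "pair_pseudo_graph (G \<star> R)"
proof unfold_locales
  have "parcs (G \<star> R) \<subseteq> Range R \<times> Range R" by (auto simp: parcs_rel_product)
  moreover have "finite (Range R)" using \<open>finite R\<close> by (rule finite_Range)
  ultimately show "finite (parcs (G \<star> R))" by (simp add: finite_subset)
  show "symmetric (with_proj (G \<star> R))"
    unfolding symmetric_def with_proj_simps
  proof (rule symI)
    fix u v assume "(u, v) \<in> parcs (G \<star> R)"
    then show "(v, u) \<in> parcs (G \<star> R)"
      using pair_pseudo_graph_arc_sym[OF assms(1)] unfolding parcs_rel_product by blast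
  qed
qed (use assms in \<open>auto simp: parcs_rel_product finite_Range\<close>)

text \<open>The arcs agree by regrouping the existential quantifiers. The hypothesis is about
  vertices: each point of \<open>Domain S\<close> is reached by \<open>R\<close>, so composing loses
  no point of \<open>Range S\<close>.\<close>

lemma rel_product_relcomp:
  assumes "Domain S = Range R"
  shows "G \<star> R \<star> S = G \<star> (R O S)"
proof (rule pair_pre_digraph.equality)
  have "(u, v) \<in> parcs (G \<star> R \<star> S) \<longleftrightarrow> (u, v) \<in> parcs (G \<star> (R O S))" for u v
    unfolding parcs_rel_product relcomp_unfold by blast
  then show "parcs (G \<star> R \<star> S) = parcs (G \<star> (R O S))" by auto
  show "pverts (G \<star> R \<star> S) = pverts (G \<star> (R O S))"
    using assms by fastforce
qed simp

text \<open>The intermediate graph \<open>C \<star> R\<close> is weakly equivalent to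
  \<open>C\<close>, with \<open>S\<close> leading back, so minimality of the core applies to it.
  Both the Hall condition and the absence of twins follow by exhibiting a suitable middle
  set.\<close>

lemma R_core_factorization:
  assumes "R_core C" and "finite R" and R: "Domain R = pverts C"
    and S: "Domain S = Range R" and C: "C \<star> (R O S) = C"
  shows "card (pverts C) \<le> card (Range R)"
proof -
  have gC: "pair_pseudo_graph C" using assms(1) by (simp add: R_core_def)
  have CRS: "C \<star> R \<star> S = C" using rel_product_relcomp[OF S] C by simp
  have RS: "Range S = pverts C" using arg_cong[OF CRS, of pverts] by simp
  have "R \<subseteq> pverts C \<times> pverts (C \<star> R)" "S \<subseteq> pverts (C \<star> R) \<times> pverts C"
    using R S RS by auto
  then have "star_equation C R (C \<star> R)" "star_equation (C \<star> R) S C"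
    using RS CRS by (simp_all add: star_equation_def)
  moreover have "pair_pseudo_graph (C \<star> R)"
    using gC \<open>finite R\<close> by (rule pair_pseudo_graph_rel_product)
  moreover have "Domain S = pverts (C \<star> R)" using S by simp
  ultimately have "C \<star> R \<sim>\<^sub>w C"
    unfolding weakly_rel_equiv_def using gC R by (intro conjI exI[of _ R] exI[of _ S])
  from R_core_minimal[OF assms(1) this] show ?thesis by simp
qed

lemma R_core_hall_condition:
  assumes core: "R_core C" and D: "Domain T = pverts C" and C: "C \<star> T = C"
    and A: "A \<subseteq> pverts C"
  shows "card A \<le> card (T `` A)"
proof -
  have gC: "pair_pseudo_graph C" using core by (simp add: R_core_def)
  have fin: "finite (pverts C)"
    using pair_pseudo_graph.axioms(1)[OF gC] by (rule pair_fin_digraph.pair_finite_verts)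
  have RT: "Range T = pverts C" using arg_cong[OF C, of pverts] by simp
  define R :: "('a \<times> ('a + 'a)) set"
    where "R = {(x, Inl x) |x. x \<in> pverts C - A} \<union> {(a, Inr y) |a y. a \<in> A \<and> (a, y) \<in> T}"
  define S :: "(('a + 'a) \<times> 'a) set"
    where "S = {(Inl x, y) |x y. x \<in> pverts C - A \<and> (x, y) \<in> T} \<union> {(Inr y, y) |y. y \<in> T `` A}"
  have R_iff: "(x, Inl z) \<in> R \<longleftrightarrow> x \<in> pverts C - A \<and> z = x"
      "(x, Inr y) \<in> R \<longleftrightarrow> x \<in> A \<and> (x, y) \<in> T" for x y z
    by (auto simp: R_def)
  have S_iff: "(Inl x, y) \<in> S \<longleftrightarrow> x \<in> pverts C - A \<and> (x, y) \<in> T"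
      "(Inr z, y) \<in> S \<longleftrightarrow> z \<in> T `` A \<and> z = y" for x y z
    by (auto simp: S_def)
  have T_total: "x \<in> pverts C \<longleftrightarrow> (\<exists>y. (x, y) \<in> T)" for x
    using D by blast
  have finT: "finite (T `` A)"
    using fin RT by (auto intro: finite_subset[of _ "pverts C"])
  have rangeR: "Range R = Inl ` (pverts C - A) \<union> Inr ` (T `` A)"
  proof (rule set_eqI)
    fix z show "z \<in> Range R \<longleftrightarrow> z \<in> Inl ` (pverts C - A) \<union> Inr ` (T `` A)"
      by (cases z) (auto simp: Range_iff R_iff)
  qed
  have "finite (Range R)" using fin finT unfolding rangeR by simp
  moreover have "R \<subseteq> pverts C \<times> Range R" using A by (auto simp: R_def)
  ultimately have finR: "finite R" using fin by (auto intro: finite_subset)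
  have "x \<in> Domain R \<longleftrightarrow> x \<in> pverts C" for x
    unfolding Domain_iff split_sum_ex R_iff using A T_total[of x] by blast
  then have "Domain R = pverts C" by blast
  moreover have "z \<in> Domain S \<longleftrightarrow> z \<in> Range R" for z
    unfolding rangeR Domain_iff using T_total by (cases z) (auto simp: S_iff)
  then have "Domain S = Range R" by blast
  moreover have "R O S = T"
  proof
    show "T \<subseteq> R O S"
    proof (rule subrelI)
      fix x y assume xy: "(x, y) \<in> T"
      show "(x, y) \<in> R O S"
      proof (cases "x \<in> A")
        case True
        with xy have "(x, Inr y) \<in> R" "(Inr y, y) \<in> S" by (auto simp: R_iff S_iff)
        then show ?thesis by blast
      next
        case False
        with xy D have "(x, Inl x) \<in> R" "(Inl x, y) \<in> S" by (auto simp: R_iff S_iff)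
        then show ?thesis by blast
      qed
    qed
  qed (auto simp: R_def S_def)
  ultimately have "card (pverts C) \<le> card (Range R)"
    using R_core_factorization[OF core finR] C by simp
  also have "card (Range R) = card (pverts C - A) + card (T `` A)"
    unfolding rangeR using fin finT by (subst card_Un_disjoint) (auto simp: card_image)
  also have "card (pverts C - A) = card (pverts C) - card A"
    using A fin by (simp add: card_Diff_subset finite_subset)
  finally show ?thesis using card_mono[OF fin A] by linarith
qed

lemma R_core_no_twins:
  assumes core: "R_core C" and x: "x \<in> pverts C" and y: "y \<in> pverts C"
    and twins: "\<And>z. (x, z) \<in> parcs C \<longleftrightarrow> (y, z) \<in> parcs C"
  shows "x = y"
proof (rule ccontr)
  assume neq: "x \<noteq> y"
  have gC: "pair_pseudo_graph C" using core by (simp add: R_core_def)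
  have fin: "finite (pverts C)"
    using pair_pseudo_graph.axioms(1)[OF gC] by (rule pair_fin_digraph.pair_finite_verts)
  have wf: "u \<in> pverts C \<and> v \<in> pverts C" if "(u, v) \<in> parcs C" for u v
    using pair_pseudo_graph_arc_sym[OF gC that] that gC
    by (meson pair_pseudo_graph.axioms(1) pair_fin_digraph.axioms(1) pair_wf_digraph.in_arcsD1)
  \<comment> \<open>\<open>g\<close> merges \<open>y\<close> into \<open>x\<close>. The way back is
    the converse of its graph \<open>R\<close>, so \<open>R O R\<inverse>\<close> is the kernel of
    \<open>g\<close>.\<close>
  define g where "g z = (if z = y then x else z)" for z
  define R where "R = (\<lambda>z. (z, g z)) ` pverts C"
  have finR: "finite R" using fin unfolding R_def by (rule finite_imageI)
  have "Range R = g ` pverts C" by (simp add: R_def Range_snd image_image)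
  also have "\<dots> \<subseteq> pverts C - {y}" using x neq unfolding g_def by auto
  finally have range: "Range R \<subseteq> pverts C - {y}" .
  have DR: "Domain R = pverts C" by (simp add: R_def Domain_fst image_image)
  have RR: "(u, v) \<in> R O R\<inverse> \<longleftrightarrow> u \<in> pverts C \<and> v \<in> pverts C \<and> g u = g v" for u v
    unfolding R_def relcomp_unfold by (auto simp: image_iff)
  have g: "(g u, w) \<in> parcs C \<longleftrightarrow> (u, w) \<in> parcs C" for u w
    using twins unfolding g_def by simp
  have twin: "(u, w) \<in> parcs C \<longleftrightarrow> (v, w) \<in> parcs C" if "g u = g v" for u v w
    using g[of u w] g[of v w] that by simp
  have "C \<star> (R O R\<inverse>) = C"
  proof (rule pair_pre_digraph.equality)
    have "(u, v) \<in> parcs (C \<star> (R O R\<inverse>)) \<longleftrightarrow> (u, v) \<in> parcs C" for u v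
    proof
      \<comment> \<open>\<open>twin\<close> replaces only the first end of an arc, so it is used
        once for each end, with a reversal of the arc in between.\<close>
      assume "(u, v) \<in> parcs (C \<star> (R O R\<inverse>))"
      then obtain a b where "(a, b) \<in> parcs C" and a: "g a = g u" and b: "g b = g v"
        unfolding parcs_rel_product RR by blast
      then have "(b, u) \<in> parcs C"
        using twin[OF a] pair_pseudo_graph_arc_sym[OF gC] by blast
      then show "(u, v) \<in> parcs C"
        using twin[OF b] pair_pseudo_graph_arc_sym[OF gC] by blast
    next
      assume "(u, v) \<in> parcs C"
      then show "(u, v) \<in> parcs (C \<star> (R O R\<inverse>))"
        using wf unfolding parcs_rel_product RR by blast
    qed
    then show "parcs (C \<star> (R O R\<inverse>)) = parcs C" by auto
    have "v \<in> Range (R O R\<inverse>) \<longleftrightarrow> v \<in> pverts C" for v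
      unfolding Range_iff RR by blast
    then show "pverts (C \<star> (R O R\<inverse>)) = pverts C" unfolding pverts_rel_product by blast
  qed simp
  then have "card (pverts C) \<le> card (Range R)"
    using R_core_factorization[OF core finR DR, of "R\<inverse>"] by simp
  also have "\<dots> \<le> card (pverts C - {y})"
    using range fin by (intro card_mono) auto
  also have "\<dots> < card (pverts C)"
    using fin y by (rule card_Diff1_less)
  finally show False by simp
qed

text \<open>A matching \<open>p\<close> inside \<open>T\<close> maps arcs of \<open>C\<close> to
  arcs of \<open>C \<star> T = C\<close>. As an injective self-map of the finite arc set it is onto,
  and this is why \<open>p\<close> also reflects arcs.\<close>

theorem R_core_automorphism:
  assumes core: "R_core C" and D: "Domain T = pverts C" and C: "C \<star> T = C"
  obtains p where "inj_on p (pverts C)" and "\<And>x. x \<in> pverts C \<Longrightarrow> (x, p x) \<in> T"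
    and "\<And>x y. x \<in> pverts C \<Longrightarrow> y \<in> pverts C \<Longrightarrow> (p x, p y) \<in> parcs C \<longleftrightarrow> (x, y) \<in> parcs C"
proof -
  interpret C: pair_pseudo_graph C using core by (simp add: R_core_def)
  have "Range T = pverts C" using arg_cong[OF C, of pverts] by simp
  then have "T \<subseteq> pverts C \<times> pverts C" using D by auto
  then have "finite T" using C.pair_finite_verts by (auto intro: finite_subset)
  then obtain p where inj: "inj_on p (pverts C)" and p: "\<And>x. x \<in> pverts C \<Longrightarrow> (x, p x) \<in> T"
    using hall[OF C.pair_finite_verts, of T] R_core_hall_condition[OF core D C] by blast
  have "(p x, p y) \<in> parcs C" if "(x, y) \<in> parcs C" for x y
  proof -
    have "(p x, p y) \<in> parcs (C \<star> T)"
      using that p C.wellformed' unfolding parcs_rel_product by blast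
    then show ?thesis using C by simp
  qed
  then have "map_prod p p ` parcs C \<subseteq> parcs C" by auto
  moreover have injp: "inj_on (map_prod p p) (pverts C \<times> pverts C)"
    using inj by (intro map_prod_inj_on)
  have sub: "parcs C \<subseteq> pverts C \<times> pverts C" using C.wellformed' by auto
  ultimately have "map_prod p p ` parcs C = parcs C"
    using C.pair_finite_arcs inj_on_subset[OF injp sub] by (intro endo_inj_surj)
  then have "(p x, p y) \<in> parcs C \<longleftrightarrow> (x, y) \<in> parcs C"
    if "x \<in> pverts C" "y \<in> pverts C" for x y
    using inj_on_image_mem_iff[OF injp _ sub, of "(x, y)"] that by auto
  with inj p show thesis by (rule that)
qed

section \<open>Induced subgraphs\<close>

lemma embedding_induced_subgraph:
  assumes G: "pair_wf_digraph G" and C: "pair_wf_digraph C"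
    and inj: "inj_on f (pverts C)" and f: "f ` pverts C \<subseteq> pverts G"
    and arcs: "\<And>x y. x \<in> pverts C \<Longrightarrow> y \<in> pverts C \<Longrightarrow>
      (f x, f y) \<in> parcs G \<longleftrightarrow> (x, y) \<in> parcs C"
  shows "\<exists>K. induced_subgraph (with_proj K) (with_proj G) \<and>
             digraph_iso (with_proj C) (with_proj K)"
proof -
  interpret C: pair_wf_digraph C by (rule C)
  define K where "K = \<lparr> pverts = f ` pverts C, parcs = map_prod f f ` parcs C \<rparr>"
  have wfK: "pair_wf_digraph K"
    using C.wellformed' by unfold_locales (auto simp: K_def)
  \<comment> \<open>Preservation of arcs by \<open>f\<close> gives one inclusion; reflection gives
    the other, which makes the image graph induced.\<close>
  have "parcs K = {e \<in> parcs G. fst e \<in> pverts K \<and> snd e \<in> pverts K}"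
    using arcs C.wellformed' by (fastforce simp: K_def)
  then have induced: "induced_subgraph (with_proj K) (with_proj G)"
    using f G wfK
    by (auto simp: induced_subgraph_def subgraph_def compatible_def wf_digraph_wp_iff K_def)
  let ?h = "\<lparr> iso_verts = f, iso_arcs = map_prod f f, iso_head = snd, iso_tail = fst \<rparr>"
  have "inj_on (map_prod f f) (parcs C)"
    using map_prod_inj_on[OF inj inj] by (rule inj_on_subset) (use C.wellformed' in auto)
  then have "pre_digraph.digraph_isomorphism (with_proj C) ?h"
    using inj C by (auto simp: pre_digraph.digraph_isomorphism_def wf_digraph_wp_iff)
  moreover have "with_proj K = app_iso ?h (with_proj C)"
    by (simp add: app_iso_def with_proj_def K_def)
  ultimately have "digraph_iso (with_proj C) (with_proj K)"
    unfolding digraph_iso_def by blast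
  with induced show ?thesis by blast
qed

theorem theorem3p17:
  fixes G :: "'a pair_pre_digraph" and C :: "'b pair_pre_digraph"
  assumes "pair_pseudo_graph G"
    and "R_core_of C G"
  shows "\<exists>K :: 'a pair_pre_digraph.
           induced_subgraph (with_proj K) (with_proj G) \<and>
           digraph_iso (with_proj C) (with_proj K)"
proof -
  have core: "R_core C" and "C \<sim>\<^sub>w G" using assms(2) by (auto simp: R_core_of_def)
  then obtain R S where DR: "Domain R = pverts C" and R: "star_equation C R G"
    and DS: "Domain S = pverts G" and S: "star_equation G S C"
    unfolding weakly_rel_equiv_def by blast
  have RR: "Range R = pverts G" and CR: "C \<star> R = G" and GS: "G \<star> S = C"
    using R S by (auto simp: star_equation_def)
  interpret C: pair_pseudo_graph C using core by (simp add: R_core_def)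
  interpret G: pair_pseudo_graph G by (rule assms(1))
  have "C \<star> (R O S) = C" using rel_product_relcomp[of S R C] DS RR CR GS by simp
  moreover have "Domain (R O S) = pverts C" using DR DS RR by fastforce
  ultimately obtain p where inj: "inj_on p (pverts C)"
    and p: "\<And>x. x \<in> pverts C \<Longrightarrow> (x, p x) \<in> R O S"
    and aut: "\<And>x y. x \<in> pverts C \<Longrightarrow> y \<in> pverts C \<Longrightarrow>
      (p x, p y) \<in> parcs C \<longleftrightarrow> (x, y) \<in> parcs C"
    using R_core_automorphism[OF core] by blast
  \<comment> \<open>Each pair \<open>(x, p x)\<close> lies in \<open>R O S\<close>;
    \<open>f x\<close> is an intermediate vertex in \<open>G\<close>.\<close>
  have "\<exists>f. \<forall>x\<in>pverts C. (x, f x) \<in> R \<and> (f x, p x) \<in> S"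
    using p by (intro bchoice) blast
  then obtain f where fR: "\<And>x. x \<in> pverts C \<Longrightarrow> (x, f x) \<in> R"
    and fS: "\<And>x. x \<in> pverts C \<Longrightarrow> (f x, p x) \<in> S" by blast
  have arcs: "(f x, f y) \<in> parcs G \<longleftrightarrow> (x, y) \<in> parcs C"
    if "x \<in> pverts C" "y \<in> pverts C" for x y
  \<comment> \<open>An arc of \<open>G\<close> is carried by \<open>S\<close> to an arc between
    values of \<open>p\<close>, which the automorphism pulls back; an arc of \<open>C\<close> is
    carried forward by \<open>R\<close>.\<close>
  proof
    assume "(f x, f y) \<in> parcs G"
    then have "(p x, p y) \<in> parcs (G \<star> S)"
      using fS that unfolding parcs_rel_product by blast
    then show "(x, y) \<in> parcs C" using aut that GS by simp
  next
    assume "(x, y) \<in> parcs C"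
    then have "(f x, f y) \<in> parcs (C \<star> R)"
      using fR that unfolding parcs_rel_product by blast
    then show "(f x, f y) \<in> parcs G" using CR by simp
  qed
  have "inj_on f (pverts C)"
  proof (rule inj_onI)
    fix x y assume x: "x \<in> pverts C" and y: "y \<in> pverts C" and "f x = f y"
    \<comment> \<open>Injectivity of \<open>p\<close> does not pass to \<open>f\<close>, because
      \<open>S\<close> may relate one vertex to several. But adjacency in \<open>C\<close> can be
      read off from \<open>f\<close>, so vertices with the same value are twins.\<close>
    then have "(x, z) \<in> parcs C \<longleftrightarrow> (y, z) \<in> parcs C" for z
      using arcs[of x z] arcs[of y z] C.wellformed' by auto
    with core x y show "x = y" by (rule R_core_no_twins)
  qed
  moreover have "f ` pverts C \<subseteq> pverts G" using fR RR by auto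
  ultimately show ?thesis
    using arcs G.pair_wf_digraph_axioms C.pair_wf_digraph_axioms
    by (intro embedding_induced_subgraph)
qed

end
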